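(* Let $\mathbb{F}$ be a field, $m,k,d,d'\in\mathbb{N}$, $\ell$ a positive integer, and $G,K,L$ finite subsets of $\mathbb{F}$ such that $K\subseteq L$, $d'\geq|G|-2$, and $|K|=d+1$. Let $B\in\mathbb{F}^{K^m\times L^m}$ be the unique matrix such that for every polynomial $P\in\mathbb{F}[X_1,\dots,X_m]$ of individual degree at most $d$ and every $\vec\alpha\in L^m$, $P(\vec\alpha)=\sum_{\vec\beta\in K^m}B_{\vec\beta,\vec\alpha}P(\vec\beta)$. If $S\subseteq\mathbb{F}^{m+k}$ is such that there exist matrices $C\in\mathbb{F}^{L^m\times\ell}$ and $D\in\mathbb{F}^{S\times\ell}$ with $$\sum_{\vec\alpha\in L^m}C_{\vec\alpha,i}\sum_{\vec y\in G^k}Z(\vec\alpha,\vec y)=\sum_{\vec q\in S}D_{\vec q,i}Z(\vec q)$$ for all $i\in\{1,\dots,\ell\}$ and all $Z\in\mathbb{F}[X_1,\dots,X_m,Y_1,\dots,Y_k]$ of individual degree at most $d$ in each $X_j$ and at most $d'$ in each $Y_j$, then $|S|\geq\mathrm{rank}(BC)\cdot\big(\min\{d'-|G|+2,\,|G|\}\big)^k$. *)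

theory Defs
  imports Complex_Main "HOL-Library.Poly_Mapping" "HOL-Library.Function_Algebras"
begin

text \<open>
  A multivariate polynomial over \<open>'a\<close> is a finitely supported map from monomials to coefficients,
  a monomial being a finitely supported map from variable indices to exponents.
  The variables of a polynomial in \<open>n\<close> variables are numbered \<open>0, \<dots>, n - 1\<close>;
  points of the \<open>n\<close>-dimensional space over \<open>'a\<close> are lists of length \<open>n\<close>.
\<close>

type_synonym 'a mpolynomial = "(nat \<Rightarrow>\<^sub>0 nat) \<Rightarrow>\<^sub>0 'a"

definition mpolynomials :: "nat \<Rightarrow> 'a::zero mpolynomial set" where
  "mpolynomials n = {P. \<forall>u \<in> Poly_Mapping.keys P. Poly_Mapping.keys u \<subseteq> {..<n}}"

text \<open>The degree in a single variable; it is 0 for the zero polynomial.\<close>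

definition degree_in :: "'a::zero mpolynomial \<Rightarrow> nat \<Rightarrow> nat" where
  "degree_in P j = Max (insert 0 ((\<lambda>u. Poly_Mapping.lookup u j) ` Poly_Mapping.keys P))"

definition mpoly_eval :: "'a::comm_semiring_1 mpolynomial \<Rightarrow> 'a list \<Rightarrow> 'a" where
  "mpoly_eval P x = (\<Sum>u \<in> Poly_Mapping.keys P. Poly_Mapping.lookup P u *
     (\<Prod>j \<in> Poly_Mapping.keys u. (x ! j) ^ Poly_Mapping.lookup u j))"

definition tuples :: "'a set \<Rightarrow> nat \<Rightarrow> 'a list set" where
  "tuples A n = {x. length x = n \<and> set x \<subseteq> A}"

text \<open>
  A matrix with rows indexed by a finite set \<open>I\<close> and columns indexed by a finite set \<open>J\<close> is a
  function of two arguments of which only the values on \<open>I\<close> and \<open>J\<close> matter. In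
  \<open>mat_rank\<close> the columns are therefore cut off outside \<open>I\<close>, which embeds the space of
  \<open>I\<close>-indexed vectors into the vector space of all functions.
\<close>

definition mat_prod :: "'j set \<Rightarrow> ('i \<Rightarrow> 'j \<Rightarrow> 'a::semiring_0) \<Rightarrow> ('j \<Rightarrow> 'k \<Rightarrow> 'a) \<Rightarrow> 'i \<Rightarrow> 'k \<Rightarrow> 'a" where
  "mat_prod J A B = (\<lambda>i k. \<Sum>j \<in> J. A i j * B j k)"

definition fun_scale :: "'a::field \<Rightarrow> ('i \<Rightarrow> 'a) \<Rightarrow> 'i \<Rightarrow> 'a" where
  "fun_scale c f = (\<lambda>i. c * f i)"

lemma vector_space_fun_scale: "vector_space fun_scale"
  by unfold_locales (auto simp: fun_scale_def fun_eq_iff algebra_simps)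

definition mat_rank :: "'i set \<Rightarrow> 'j set \<Rightarrow> ('i \<Rightarrow> 'j \<Rightarrow> 'a::field) \<Rightarrow> nat" where
  "mat_rank I J A =
     vector_space.dim fun_scale ((\<lambda>j. \<lambda>i. if i \<in> I then A i j else 0) ` J)"

end

theory Submission
  imports Defs "HOL-Computational_Algebra.Polynomial" "HOL-Library.FuncSet"
begin

text \<open>
  Let \<open>t\<close> be the minimum of \<open>d' - |G| + 2\<close> and \<open>|G|\<close>, choose \<open>T \<subseteq> G\<close> with \<open>|T| = t\<close>, and let
  \<open>U\<^sub>\<tau>\<close>, for \<open>\<tau> \<in> T\<^sup>k\<close>, be the Lagrange polynomials of the grid \<open>T\<^sup>k\<close>; they have individual degree less
  than \<open>t\<close>. Let \<open>i\<close> range over the indices of a basis of the column space of \<open>BC\<close>. The vectors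
  \<open>D q i * U\<^sub>\<tau>(q\<^sub>Y)\<close> in \<open>q \<in> S\<close> are linearly independent: a linear relation between them, multiplied by
  the Lagrange polynomial \<open>W\<close> of a point \<open>(\<beta>, y)\<close> of the grid \<open>K\<^sup>m \<times> G\<^sup>k\<close> with \<open>y \<in> T\<^sup>k\<close> and summed
  over \<open>S\<close>, involves only polynomials \<open>U\<^sub>\<tau> W\<close> of admissible degree, so the hypothesis turns it into a
  relation between the values at \<open>\<beta>\<close> of the chosen columns of \<open>BC\<close>, with the coefficients belonging
  to \<open>\<tau> = y\<close>.
\<close>

section \<open>Lagrange interpolation in one variable and on grids\<close>

definition lagrange_poly :: "'a::field set \<Rightarrow> 'a \<Rightarrow> 'a poly" where
  "lagrange_poly A a = (\<Prod>b \<in> A - {a}. smult (inverse (a - b)) [:- b, 1:])"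

lemma poly_lagrange_poly:
  assumes "finite A" "x \<in> A"
  shows "poly (lagrange_poly A a) x = (if x = a then 1 else 0)"
proof (cases "x = a")
  case True
  have "poly (smult (inverse (a - b)) [:- b, 1:]) a = 1" if "b \<noteq> a" for b
  proof -
    have "poly (smult (inverse (a - b)) [:- b, 1:]) a = inverse (a - b) * (a - b)"
      by (simp add: algebra_simps)
    then show ?thesis
      using that by (metis left_inverse right_minus_eq)
  qed
  then show ?thesis
    unfolding lagrange_poly_def poly_prod True by (simp add: prod.neutral)
next
  case False
  with assms show ?thesis
    by (auto simp: lagrange_poly_def poly_prod intro!: prod_zero bexI[of _ x])
qed

lemma degree_lagrange_poly:
  assumes "finite A" "a \<in> A"
  shows "degree (lagrange_poly A a) \<le> card A - 1"
proof -
  have "degree (lagrange_poly A a) \<le> (\<Sum>b \<in> A - {a}. degree (smult (inverse (a - b)) [:- b, 1:]))"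
    unfolding lagrange_poly_def
    by (rule order_trans[OF degree_prod_sum_le]) (use assms in \<open>simp_all only: finite_Diff o_def order_refl\<close>)
  also have "\<dots> \<le> (\<Sum>b \<in> A - {a}. 1)"
    by (intro sum_mono order_trans[OF degree_smult_le]) simp
  also have "\<dots> = card A - 1"
    using assms by simp
  finally show ?thesis .
qed

lemma prod_poly_lagrange_poly:
  assumes "finite A" "a \<in> tuples A n" "x \<in> tuples A n"
  shows "(\<Prod>j<n. poly (lagrange_poly A (a ! j)) (x ! j)) = (if x = a then 1 else 0)"
proof -
  have nth: "x ! j \<in> A" if "j < n" for j
    using assms that by (auto simp: tuples_def)
  have "(\<Prod>j<n. poly (lagrange_poly A (a ! j)) (x ! j)) = (\<Prod>j<n. if x ! j = a ! j then 1 else 0)"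
    by (intro prod.cong refl) (simp add: poly_lagrange_poly assms(1) nth)
  also have "\<dots> = (if x = a then 1 else 0)"
  proof (cases "x = a")
    case False
    then obtain j where "j < n" "x ! j \<noteq> a ! j"
      using assms by (auto simp: tuples_def list_eq_iff_nth_eq)
    then show ?thesis
      using False by (auto intro!: prod_zero)
  qed simp
  finally show ?thesis .
qed

lemma finite_tuples: "finite A \<Longrightarrow> finite (tuples A n)"
  using finite_lists_length_eq[of A n] by (simp add: tuples_def conj_commute)

lemma card_tuples: "finite A \<Longrightarrow> card (tuples A n) = card A ^ n"
  using card_lists_length_eq[of A n] by (simp add: tuples_def conj_commute)

section \<open>Evaluation and individual degrees of multivariate polynomials\<close>

lemma mpoly_eval_superset:
  assumes "finite A" "Poly_Mapping.keys P \<subseteq> A"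
  shows "mpoly_eval P x = (\<Sum>u \<in> A. Poly_Mapping.lookup P u *
     (\<Prod>j \<in> Poly_Mapping.keys u. (x ! j) ^ Poly_Mapping.lookup u j))"
  unfolding mpoly_eval_def
  by (rule sum.mono_neutral_left) (use assms in \<open>auto simp: in_keys_iff\<close>)

text \<open>Cancellation can make the keys of \<open>P + Q\<close> a proper subset of the union of
  the keys of \<open>P\<close> and \<open>Q\<close>, so all three evaluations are expanded over that
  union before they are compared.\<close>

lemma mpoly_eval_add: "mpoly_eval (P + Q) x = mpoly_eval P x + mpoly_eval Q x"
  using mpoly_eval_superset[of "Poly_Mapping.keys P \<union> Poly_Mapping.keys Q" P x]
    mpoly_eval_superset[of "Poly_Mapping.keys P \<union> Poly_Mapping.keys Q" Q x]
    mpoly_eval_superset[of "Poly_Mapping.keys P \<union> Poly_Mapping.keys Q" "P + Q" x]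
    Poly_Mapping.keys_add[of P Q]
  by (simp add: lookup_add distrib_right sum.distrib)

lemma mpoly_eval_sum: "mpoly_eval (\<Sum>i \<in> I. P i) x = (\<Sum>i \<in> I. mpoly_eval (P i) x)"
proof (induction I rule: infinite_finite_induct)
  case (insert i I)
  then show ?case by (simp add: mpoly_eval_add)
qed (simp_all add: mpoly_eval_def)

lemma mpoly_eval_single:
  "mpoly_eval (Poly_Mapping.single u c) x =
     c * (\<Prod>j \<in> Poly_Mapping.keys u. (x ! j) ^ Poly_Mapping.lookup u j)"
  using mpoly_eval_superset[of "{u}" "Poly_Mapping.single u c" x] by simp

lemma degree_in_le_iff:
  "degree_in P j \<le> e \<longleftrightarrow> (\<forall>u \<in> Poly_Mapping.keys P. Poly_Mapping.lookup u j \<le> e)"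
  by (simp add: degree_in_def)

text \<open>This turns products of Lagrange polynomials in separate variables into objects to which
  the hypotheses of the theorem apply. Distributivity gives \<open>P\<close>: one monomial for each
  choice of an exponent in every factor \<open>f j\<close>, so no exponent of variable
  \<open>j\<close> exceeds the degree of \<open>f j\<close>.\<close>

lemma product_mpolynomial:
  fixes f :: "nat \<Rightarrow> 'a::comm_semiring_1 poly"
  obtains P where "P \<in> mpolynomials n" "\<And>j. j < n \<Longrightarrow> degree_in P j \<le> degree (f j)"
    "\<And>x. mpoly_eval P x = (\<Prod>j<n. poly (f j) (x ! j))"
proof -
  define E where "E = PiE {..<n} (\<lambda>j. {..degree (f j)})"
  \<comment> \<open>Elements of \<open>E\<close> take the value \<open>undefined\<close> from
    \<open>n\<close> on; replacing it by 0 gives the finite support that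
    \<open>Abs_poly_mapping\<close> requires.\<close>
  define expo where "expo e = Poly_Mapping.Abs_poly_mapping (\<lambda>j. if j < n then e j else 0)"
    for e :: "nat \<Rightarrow> nat"
  define P where "P = (\<Sum>e \<in> E. Poly_Mapping.single (expo e) (\<Prod>j<n. coeff (f j) (e j)))"
  have lookup_expo: "Poly_Mapping.lookup (expo e) j = (if j < n then e j else 0)" for e j
    unfolding expo_def by (subst Abs_poly_mapping_inverse) auto
  have keys_expo: "Poly_Mapping.keys (expo e) \<subseteq> {..<n}" for e
    by (auto simp: in_keys_iff lookup_expo split: if_splits)
  have keys_P: "Poly_Mapping.keys P \<subseteq> expo ` E"
    unfolding P_def by (rule order_trans[OF Poly_Mapping.keys_sum]) (auto split: if_splits)
  show thesis
  proof
    show "P \<in> mpolynomials n"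
      using keys_P keys_expo by (fastforce simp: mpolynomials_def)
    show "degree_in P j \<le> degree (f j)" if "j < n" for j
      using keys_P that by (fastforce simp: degree_in_le_iff lookup_expo E_def)
    fix x
    have "mpoly_eval P x = (\<Sum>e \<in> E. (\<Prod>j<n. coeff (f j) (e j)) * (\<Prod>j<n. (x ! j) ^ e j))"
      unfolding P_def mpoly_eval_sum mpoly_eval_single
    proof (intro sum.cong refl arg_cong2[of _ _ _ _ times])
      fix e
      have "(\<Prod>j \<in> Poly_Mapping.keys (expo e). (x ! j) ^ Poly_Mapping.lookup (expo e) j) =
          (\<Prod>j<n. (x ! j) ^ Poly_Mapping.lookup (expo e) j)"
        by (rule prod.mono_neutral_left) (use keys_expo in \<open>auto simp: in_keys_iff\<close>)
      then show "(\<Prod>j \<in> Poly_Mapping.keys (expo e). (x ! j) ^ Poly_Mapping.lookup (expo e) j) =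
          (\<Prod>j<n. (x ! j) ^ e j)"
        by (simp add: lookup_expo)
    qed
    also have "\<dots> = (\<Prod>j<n. \<Sum>i\<le>degree (f j). coeff (f j) i * (x ! j) ^ i)"
      unfolding E_def by (subst prod_sum_PiE) (auto simp: prod.distrib)
    finally show "mpoly_eval P x = (\<Prod>j<n. poly (f j) (x ! j))"
      by (simp add: poly_altdef)
  qed
qed

section \<open>Linear independence and matrix rank\<close>

lemma sum_fun_apply: "(\<Sum>i \<in> I. f i) x = (\<Sum>i \<in> I. f i x)"
  by (induction I rule: infinite_finite_induct) auto

text \<open>Independence is stated for a family, which also excludes repetitions: two equal vectors
  would satisfy the relation with coefficients 1 and -1. Extended by 0 outside \<open>S\<close>, the
  vectors lie in the span of the unit vectors \<open>\<delta> p\<close> with \<open>p\<close> in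
  \<open>S\<close>, which bounds their number.\<close>

lemma independent_family_card_le:
  fixes v :: "'i \<Rightarrow> 's \<Rightarrow> 'a::field"
  assumes "finite I" "finite S"
    and indep: "\<And>c. (\<And>q. q \<in> S \<Longrightarrow> (\<Sum>i \<in> I. c i * v i q) = 0) \<Longrightarrow> \<forall>i \<in> I. c i = 0"
  shows "card I \<le> card S"
proof -
  interpret F: vector_space "fun_scale :: 'a \<Rightarrow> ('s \<Rightarrow> 'a) \<Rightarrow> 's \<Rightarrow> 'a"
    by (rule vector_space_fun_scale)
  define w where "w i = (\<lambda>q. if q \<in> S then v i q else 0)" for i
  define \<delta> :: "'s \<Rightarrow> 's \<Rightarrow> 'a" where "\<delta> p = (\<lambda>q. if q = p then 1 else 0)" for p
  have inj: "inj_on w I"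
  proof (rule inj_onI, rule ccontr)
    fix i i' assume *: "i \<in> I" "i' \<in> I" "w i = w i'" "i \<noteq> i'"
    define c :: "'i \<Rightarrow> 'a" where "c = (\<lambda>h. (if h = i then 1 else 0) - (if h = i' then 1 else 0))"
    have "(\<Sum>h \<in> I. c h * v h q) = 0" if "q \<in> S" for q
    proof -
      have "(\<Sum>h \<in> I. c h * v h q) =
          (\<Sum>h \<in> I. (if h = i then v h q else 0) - (if h = i' then v h q else 0))"
        by (intro sum.cong) (auto simp: c_def)
      also have "\<dots> = v i q - v i' q"
        using * \<open>finite I\<close> by (simp add: sum_subtractf)
      also have "\<dots> = 0"
        using fun_cong[OF *(3), of q] that by (simp add: w_def)
      finally show ?thesis .
    qed
    then have "c i = 0"
      using indep[of c] * by blast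
    then show False
      using * by (simp add: c_def)
  qed
  have "F.independent (w ` I)"
  proof (rule F.independent_if_scalars_zero)
    fix c x assume zero: "(\<Sum>x \<in> w ` I. fun_scale (c x) x) = 0" and "x \<in> w ` I"
    have "(\<Sum>i \<in> I. c (w i) * v i q) = 0" if "q \<in> S" for q
      using fun_cong[OF zero, of q] that
      by (simp add: sum.reindex[OF inj] sum_fun_apply fun_scale_def) (simp add: w_def)
    then show "c x = 0"
      using indep[of "\<lambda>i. c (w i)"] \<open>x \<in> w ` I\<close> by blast
  qed (use \<open>finite I\<close> in simp)
  moreover have "w ` I \<subseteq> F.span (\<delta> ` S)"
  proof safe
    fix i
    have "w i = (\<Sum>p \<in> S. fun_scale (v i p) (\<delta> p))"
      using \<open>finite S\<close> by (auto simp: fun_eq_iff sum_fun_apply fun_scale_def w_def \<delta>_def if_distrib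
          cong: if_cong)
    also have "\<dots> \<in> F.span (\<delta> ` S)"
      by (intro F.span_sum F.span_scale F.span_base) auto
    finally show "w i \<in> F.span (\<delta> ` S)" .
  qed
  ultimately have "card (w ` I) \<le> card (\<delta> ` S)"
    using F.independent_span_bound[of "\<delta> ` S" "w ` I"] \<open>finite S\<close> by simp
  then show ?thesis
    using card_image[OF inj] card_image_le[OF \<open>finite S\<close>, of \<delta>] by simp
qed

text \<open>A basis of the column space can be chosen among the columns. Selecting one index per
  basis vector makes \<open>col\<close> injective on \<open>J'\<close>, so a relation indexed by
  \<open>J'\<close> is a relation between distinct basis vectors.\<close>

lemma mat_rank_independent_columns:
  fixes A :: "'i \<Rightarrow> 'j \<Rightarrow> 'a::field"
  assumes "finite J"
  obtains J' where "J' \<subseteq> J" "card J' = mat_rank I J A"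
    "\<And>c. (\<And>i. i \<in> I \<Longrightarrow> (\<Sum>j \<in> J'. c j * A i j) = 0) \<Longrightarrow> \<forall>j \<in> J'. c j = 0"
proof -
  interpret F: vector_space "fun_scale :: 'a \<Rightarrow> ('i \<Rightarrow> 'a) \<Rightarrow> 'i \<Rightarrow> 'a"
    by (rule vector_space_fun_scale)
  define col where "col j = (\<lambda>i. if i \<in> I then A i j else 0)" for j
  obtain Bs where Bs: "Bs \<subseteq> col ` J" "F.independent Bs" "card Bs = F.dim (col ` J)"
    using F.basis_exists by metis
  then obtain J' where J': "J' \<subseteq> J" "inj_on col J'" "Bs = col ` J'"
    by (metis subset_image_inj)
  have fin: "finite J'"
    using J' assms finite_subset by blast
  show thesis
  proof
    show "J' \<subseteq> J" by fact
    show "card J' = mat_rank I J A"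
      using Bs J' card_image[of col J'] by (simp add: mat_rank_def col_def)
    fix c assume c: "\<And>i. i \<in> I \<Longrightarrow> (\<Sum>j \<in> J'. c j * A i j) = 0"
    have "(\<Sum>x \<in> Bs. fun_scale (c (the_inv_into J' col x)) x) = (\<Sum>j \<in> J'. fun_scale (c j) (col j))"
      using J' by (simp add: sum.reindex the_inv_into_f_f)
    also have "\<dots> = 0"
    proof
      fix i
      show "(\<Sum>j \<in> J'. fun_scale (c j) (col j)) i = 0 i"
        by (cases "i \<in> I") (simp_all add: sum_fun_apply fun_scale_def col_def c)
    qed
    finally have "\<forall>x \<in> Bs. c (the_inv_into J' col x) = 0"
      using F.independentD[OF Bs(2), of Bs "\<lambda>x. c (the_inv_into J' col x)"] J' fin by blast
    then show "\<forall>j \<in> J'. c j = 0"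
      using J' by (auto simp: the_inv_into_f_f)
  qed
qed

section \<open>The lower bound for the size of \<open>S\<close>\<close>

theorem theorem5p1:
  fixes m k d d' l :: nat
    and G K L :: "'a::field set"
    and B :: "'a list \<Rightarrow> 'a list \<Rightarrow> 'a"
    and C D :: "'a list \<Rightarrow> nat \<Rightarrow> 'a"
    and S :: "'a list set"
  assumes "l > 0"
    and "finite G" and "finite K" and "finite L"
    and "K \<subseteq> L"
    and "int d' \<ge> int (card G) - 2"
    and "card K = d + 1"
    and B: "\<And>P \<alpha>. \<lbrakk>P \<in> mpolynomials m; \<forall>j<m. degree_in P j \<le> d; \<alpha> \<in> tuples L m\<rbrakk> \<Longrightarrow>
      mpoly_eval P \<alpha> = (\<Sum>\<beta> \<in> tuples K m. B \<beta> \<alpha> * mpoly_eval P \<beta>)"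
    and "S \<subseteq> tuples UNIV (m + k)" and "finite S"
    and CD: "\<And>i Z. \<lbrakk>i \<in> {1..l}; Z \<in> mpolynomials (m + k); \<forall>j<m. degree_in Z j \<le> d;
        \<forall>j\<in>{m..<m + k}. degree_in Z j \<le> d'\<rbrakk> \<Longrightarrow>
      (\<Sum>\<alpha> \<in> tuples L m. C \<alpha> i * (\<Sum>y \<in> tuples G k. mpoly_eval Z (\<alpha> @ y))) =
      (\<Sum>q \<in> S. D q i * mpoly_eval Z q)"
  shows "int (card S) \<ge>
    int (mat_rank (tuples K m) {1..l} (mat_prod (tuples L m) B C)) *
    (min (int d' - int (card G) + 2) (int (card G))) ^ k"
proof -
  define t where "t = nat (min (int d' - int (card G) + 2) (int (card G)))"
  \<comment> \<open>The lower bound on \<open>d'\<close> makes the minimum nonnegative, so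
    \<open>nat\<close> does not truncate it.\<close>
  have t: "int t = min (int d' - int (card G) + 2) (int (card G))"
    using assms(6) by (simp add: t_def)
  then have "t \<le> card G" by linarith
  then obtain T where T: "T \<subseteq> G" "card T = t" "finite T"
    using obtain_subset_with_card_n by metis
  define M where "M = mat_prod (tuples L m) B C"
  obtain J where J: "J \<subseteq> {1..l}" "card J = mat_rank (tuples K m) {1..l} M"
    and J_indep: "\<And>c. (\<And>\<beta>. \<beta> \<in> tuples K m \<Longrightarrow> (\<Sum>i \<in> J. c i * M \<beta> i) = 0) \<Longrightarrow> \<forall>i \<in> J. c i = 0"
    by (rule mat_rank_independent_columns[of "{1..l}" "tuples K m" M]) simp_all
  have "finite J"
    using J(1) finite_subset by blast

  \<comment> \<open>\<open>PK\<close> looks only at the first \<open>m\<close> coordinates, hence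
    applies both to points of \<open>L^m\<close> and to points \<open>\<alpha> @ z\<close>;
    \<open>U\<close> and \<open>W\<close> read the \<open>k\<close> coordinates after these.\<close>
  define PK where "PK \<beta> x = (\<Prod>j<m. poly (lagrange_poly K (\<beta> ! j)) (x ! j))" for \<beta> x
  define U where "U \<tau> x = (\<Prod>j<k. poly (lagrange_poly T (\<tau> ! j)) (x ! (m + j)))" for \<tau> x
  define W where "W y x = (\<Prod>j<k. poly (lagrange_poly G (y ! j)) (x ! (m + j)))" for y x

  \<comment> \<open>Row \<open>\<beta>\<close> of \<open>B\<close> is the Lagrange polynomial of
    \<open>\<beta>\<close> evaluated on \<open>L^m\<close>: in its interpolation formula only the
    term of \<open>\<beta>\<close> survives.\<close>
  have B_eq: "PK \<beta> \<alpha> = B \<beta> \<alpha>" if \<beta>: "\<beta> \<in> tuples K m" and \<alpha>: "\<alpha> \<in> tuples L m" for \<alpha> \<beta>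
  proof -
    obtain P where P: "P \<in> mpolynomials m"
        "\<And>j. j < m \<Longrightarrow> degree_in P j \<le> degree (lagrange_poly K (\<beta> ! j))"
        "\<And>x. mpoly_eval P x = PK \<beta> x"
      unfolding PK_def using product_mpolynomial[of m "\<lambda>j. lagrange_poly K (\<beta> ! j)"] by metis
    have "degree_in P j \<le> d" if "j < m" for j
      using P(2)[OF that] degree_lagrange_poly[of K "\<beta> ! j"] \<beta> that \<open>finite K\<close> \<open>card K = d + 1\<close>
      by (force simp: tuples_def)
    then have "PK \<beta> \<alpha> = (\<Sum>\<beta>' \<in> tuples K m. B \<beta>' \<alpha> * PK \<beta> \<beta>')"
      using B[of P \<alpha>] P \<alpha> by simp
    also have "\<dots> = (\<Sum>\<beta>' \<in> tuples K m. if \<beta>' = \<beta> then B \<beta> \<alpha> else 0)"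
      unfolding PK_def by (intro sum.cong refl) (simp add: prod_poly_lagrange_poly \<open>finite K\<close> \<beta>)
    finally show ?thesis
      using \<beta> finite_tuples[OF \<open>finite K\<close>] by simp
  qed

  \<comment> \<open>The product of the three factors serves as the test polynomial \<open>Z\<close>.
    Summing it over \<open>G^k\<close> leaves \<open>B \<beta> \<alpha>\<close> times the indicator
    of \<open>\<tau> = y\<close>, and summing this against \<open>C\<close> over \<open>L^m\<close>
    produces an entry of \<open>BC\<close>.\<close>
  have key: "(\<Sum>q \<in> S. D q i * (PK \<beta> q * U \<tau> q * W y q)) = (if \<tau> = y then M \<beta> i else 0)"
    if i: "i \<in> {1..l}" and \<beta>: "\<beta> \<in> tuples K m" and \<tau>: "\<tau> \<in> tuples T k" and y: "y \<in> tuples T k"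
    for i \<beta> \<tau> y
  proof -
    have yG: "y \<in> tuples G k"
      using y T(1) by (auto simp: tuples_def)
    define f where "f j = (if j < m then lagrange_poly K (\<beta> ! j)
      else lagrange_poly T (\<tau> ! (j - m)) * lagrange_poly G (y ! (j - m)))" for j
    have split: "(\<Prod>j<m + k. poly (f j) (x ! j)) = PK \<beta> x * U \<tau> x * W y x" for x
    proof -
      have "{..<m + k} = {..<m} \<union> (\<lambda>j. m + j) ` {..<k}"
        using image_add_atLeastLessThan[of m 0 k] by (auto simp: atLeast0LessThan)
      then have "(\<Prod>j<m + k. poly (f j) (x ! j)) =
          (\<Prod>j<m. poly (f j) (x ! j)) * (\<Prod>j \<in> (\<lambda>j. m + j) ` {..<k}. poly (f j) (x ! j))"
        by (simp only:) (rule prod.union_disjoint, auto)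
      then show ?thesis
        by (simp add: prod.reindex f_def PK_def U_def W_def prod.distrib mult.assoc)
    qed
    obtain Z where Z: "Z \<in> mpolynomials (m + k)"
        "\<And>j. j < m + k \<Longrightarrow> degree_in Z j \<le> degree (f j)"
        "\<And>x. mpoly_eval Z x = PK \<beta> x * U \<tau> x * W y x"
      using product_mpolynomial[of "m + k" f] unfolding split by metis
    have "degree_in Z j \<le> d" if "j < m" for j
      using Z(2)[of j] degree_lagrange_poly[of K "\<beta> ! j"] \<beta> that \<open>finite K\<close> \<open>card K = d + 1\<close>
      by (force simp: tuples_def f_def)
    moreover have "degree_in Z j \<le> d'" if j: "j \<in> {m..<m + k}" for j
    proof -
      have nth: "\<tau> ! (j - m) \<in> T" "y ! (j - m) \<in> G"
        using j \<tau> yG by (auto simp: tuples_def)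
      \<comment> \<open>With \<open>t \<le> card G\<close> this makes both natural number
        subtractions below exact; the bound by \<open>d'\<close> is then
        \<open>t \<le> d' - card G + 2\<close>, the reason for the first term of the
        minimum.\<close>
      then have "t > 0"
        using T by (auto simp: card_gt_0_iff)
      have "degree_in Z j \<le> degree (lagrange_poly T (\<tau> ! (j - m))) + degree (lagrange_poly G (y ! (j - m)))"
        using Z(2)[of j] degree_mult_le[of "lagrange_poly T (\<tau> ! (j - m))" "lagrange_poly G (y ! (j - m))"] j
        by (simp add: f_def)
      also have "\<dots> \<le> (t - 1) + (card G - 1)"
        using degree_lagrange_poly[OF T(3) nth(1)] degree_lagrange_poly[OF \<open>finite G\<close> nth(2)] T(2)
        by linarith
      also have "\<dots> \<le> d'"
        using t \<open>t > 0\<close> by linarith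
      finally show ?thesis .
    qed
    ultimately have "(\<Sum>q \<in> S. D q i * mpoly_eval Z q) =
        (\<Sum>\<alpha> \<in> tuples L m. C \<alpha> i * (\<Sum>z \<in> tuples G k. mpoly_eval Z (\<alpha> @ z)))"
      using CD[OF i Z(1)] by simp
    also have "\<dots> = (\<Sum>\<alpha> \<in> tuples L m. C \<alpha> i * (B \<beta> \<alpha> * (if \<tau> = y then 1 else 0)))"
    proof (intro sum.cong refl arg_cong2[of _ _ _ _ times])
      fix \<alpha> assume \<alpha>: "\<alpha> \<in> tuples L m"
      have len: "length \<alpha> = m"
        using \<alpha> by (simp add: tuples_def)
      have "PK \<beta> (\<alpha> @ z) = B \<beta> \<alpha>" for z
        using B_eq[OF \<beta> \<alpha>] len by (simp add: PK_def nth_append)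
      moreover have "W y (\<alpha> @ z) = (if z = y then 1 else 0)" if "z \<in> tuples G k" for z
        using prod_poly_lagrange_poly[OF \<open>finite G\<close> yG that] len by (simp add: W_def nth_append)
      \<comment> \<open>\<open>U \<tau>\<close> is known to be an indicator only on
        \<open>T^k\<close>, while \<open>z\<close> runs over \<open>G^k\<close>. The factor
        \<open>W y\<close> removes every \<open>z\<close> other than \<open>y\<close>, and
        \<open>y\<close> does lie in \<open>T^k\<close>.\<close>
      moreover have "U \<tau> (\<alpha> @ y) = (if \<tau> = y then 1 else 0)"
        using prod_poly_lagrange_poly[OF \<open>finite T\<close> \<tau> y] len by (auto simp: U_def nth_append)
      ultimately have "(\<Sum>z \<in> tuples G k. mpoly_eval Z (\<alpha> @ z)) =
          (\<Sum>z \<in> tuples G k. if z = y then B \<beta> \<alpha> * (if \<tau> = y then 1 else 0) else 0)"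
        unfolding Z(3) by (intro sum.cong refl) auto
      then show "(\<Sum>z \<in> tuples G k. mpoly_eval Z (\<alpha> @ z)) = B \<beta> \<alpha> * (if \<tau> = y then 1 else 0)"
        using yG finite_tuples[OF \<open>finite G\<close>] by simp
    qed
    also have "\<dots> = (if \<tau> = y then M \<beta> i else 0)"
      by (simp add: M_def mat_prod_def mult.commute)
    finally show ?thesis
      by (simp add: Z(3))
  qed

  have "card (J \<times> tuples T k) \<le> card S"
  proof (rule independent_family_card_le[where v = "\<lambda>(i, \<tau>) q. D q i * U \<tau> q"])
    show "finite (J \<times> tuples T k)"
      using \<open>finite J\<close> finite_tuples[OF \<open>finite T\<close>] by simp
    fix c :: "nat \<times> 'a list \<Rightarrow> 'a"
    assume rel: "\<And>q. q \<in> S \<Longrightarrow> (\<Sum>p \<in> J \<times> tuples T k. c p * (case p of (i, \<tau>) \<Rightarrow> \<lambda>q. D q i * U \<tau> q) q) = 0"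
    have "c (i, y) = 0" if "i \<in> J" and y: "y \<in> tuples T k" for i y
    proof -
      have "(\<Sum>i \<in> J. c (i, y) * M \<beta> i) = 0" if \<beta>: "\<beta> \<in> tuples K m" for \<beta>
      proof -
        \<comment> \<open>Inserting the terms with \<open>\<tau>\<close> different from
          \<open>y\<close>, which are 0, allows \<open>key\<close> to rewrite every entry as a sum
          over \<open>S\<close>. The weight \<open>PK \<beta> q * W y q\<close> depends on neither
          \<open>i\<close> nor \<open>\<tau>\<close>, so after exchanging the sums the inner one is
          the assumed relation at \<open>q\<close>.\<close>
        have "(\<Sum>i \<in> J. c (i, y) * M \<beta> i) =
            (\<Sum>i \<in> J. \<Sum>\<tau> \<in> tuples T k. if \<tau> = y then c (i, \<tau>) * M \<beta> i else 0)"
          using y finite_tuples[OF \<open>finite T\<close>] by simp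
        also have "\<dots> = (\<Sum>i \<in> J. \<Sum>\<tau> \<in> tuples T k.
            c (i, \<tau>) * (\<Sum>q \<in> S. D q i * (PK \<beta> q * U \<tau> q * W y q)))"
          using J(1) by (intro sum.cong refl) (auto simp: key \<beta> y subset_iff)
        also have "\<dots> = (\<Sum>(i, \<tau>) \<in> J \<times> tuples T k. \<Sum>q \<in> S.
            PK \<beta> q * W y q * (c (i, \<tau>) * (D q i * U \<tau> q)))"
          by (subst sum.cartesian_product) (simp add: sum_distrib_left mult_ac)
        also have "\<dots> = (\<Sum>q \<in> S. PK \<beta> q * W y q *
            (\<Sum>(i, \<tau>) \<in> J \<times> tuples T k. c (i, \<tau>) * (D q i * U \<tau> q)))"
          unfolding sum_distrib_left case_prod_unfold by (rule sum.swap)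
        also have "\<dots> = 0"
          using rel by (simp add: case_prod_unfold)
        finally show ?thesis .
      qed
      then show ?thesis
        using J_indep[of "\<lambda>i. c (i, y)"] \<open>i \<in> J\<close> by blast
    qed
    then show "\<forall>p \<in> J \<times> tuples T k. c p = 0"
      by auto
  qed (use \<open>finite S\<close> in simp)
  then have "mat_rank (tuples K m) {1..l} M * t ^ k \<le> card S"
    using J(2) T by (simp add: card_cartesian_product card_tuples)
  then have "int (mat_rank (tuples K m) {1..l} M) * int t ^ k \<le> int (card S)"
    by (metis of_nat_le_iff of_nat_mult of_nat_power)
  then show ?thesis
    by (simp only: t M_def)
qed

end
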